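(* Let $\mathcal F$ be a hypergraph and let $\alpha(\mathcal F)$ be its independence number. Then for any prime number $p$, $$\chi_l(\mathrm{KG}^2(\mathcal F))\geq\left\lceil\frac{(p-1)|V(\mathcal F)|}{p}\right\rceil-(p-1)\cdot\alpha(\mathcal F)+1.$$
   Context: A hypergraph $\mathcal F$ has a finite vertex set $V(\mathcal F)$ and an edge set $E(\mathcal F)$ which is a family of nonempty subsets of $V(\mathcal F)$. The independence number $\alpha(\mathcal F)$ is the maximum size of a subset of $V(\mathcal F)$ containing no edge of $\mathcal F$. The Kneser graph $\mathrm{KG}^2(\mathcal F)$ has vertex set $E(\mathcal F)$, two edges of $\mathcal F$ being adjacent iff they are disjoint. For a graph $G$ and $v\in V(G)$, $N[v]=\{v\}\cup\{u:uv\in E(G)\}$, and the local chromatic number is $\chi_l(G)=\min_c\max\{|c(N[v])|:v\in V(G)\}$, the minimum over all proper colorings $c$ of $G$ (with any number of colors).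
   Formalization: The formal theorem assumes F has an edge; that p ≤ |V(F)| if α(F)=0; and that two edges are disjoint if p=2 and |V(F)|=2α(F)+1. Without these the claim is undefined or false (e.g. one vertex, one edge, p=2). *)

theory Defs
  imports Complex_Main "HOL-Computational_Algebra.Primes"
begin

definition hypergraph :: "'a set \<Rightarrow> 'a set set \<Rightarrow> bool" where
  "hypergraph V E \<longleftrightarrow> finite V \<and> (\<forall>e\<in>E. e \<noteq> {} \<and> e \<subseteq> V)"

definition independent_set :: "'a set \<Rightarrow> 'a set set \<Rightarrow> 'a set \<Rightarrow> bool" where
  "independent_set V E S \<longleftrightarrow> S \<subseteq> V \<and> (\<forall>e\<in>E. \<not> e \<subseteq> S)"

definition independence_number :: "'a set \<Rightarrow> 'a set set \<Rightarrow> nat" where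
  "independence_number V E = Max (card ` {S. independent_set V E S})"

record 'v graph =
  verts :: "'v set"
  adj :: "'v \<Rightarrow> 'v \<Rightarrow> bool"

text \<open>Since the edges of a hypergraph are nonempty, the adjacency relation below is irreflexive.\<close>

definition kneser_graph :: "'a set set \<Rightarrow> 'a set graph" where
  "kneser_graph E = \<lparr>verts = E, adj = (\<lambda>e f. e \<in> E \<and> f \<in> E \<and> e \<inter> f = {})\<rparr>"

definition closed_nbhd :: "'v graph \<Rightarrow> 'v \<Rightarrow> 'v set" where
  "closed_nbhd G v = insert v {u \<in> verts G. adj G u v}"

definition proper_coloring :: "'v graph \<Rightarrow> ('v \<Rightarrow> nat) \<Rightarrow> bool" where
  "proper_coloring G c \<longleftrightarrow> (\<forall>u\<in>verts G. \<forall>v\<in>verts G. adj G u v \<longrightarrow> c u \<noteq> c v)"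

text \<open>
  Meant for finite graphs with at least one vertex: a coloring then uses finitely many colors, so
  that natural numbers suffice as colors; the maximum is over a finite nonempty set; and the
  infimum, over a nonempty set of natural numbers, is a minimum.
\<close>

definition local_chromatic_number :: "'v graph \<Rightarrow> nat" where
  "local_chromatic_number G =
     (INF c\<in>{c. proper_coloring G c}. Max ((\<lambda>v. card (c ` closed_nbhd G v)) ` verts G))"

end

theory Submission
  imports Defs "HOL-Library.Multiset"
begin

text \<open>
  Write \<open>n\<close> for the number of vertices, \<open>\<alpha>\<close> for the independence number, \<open>L\<close> for the local
  chromatic number of the Kneser graph and \<open>t = n - p \<alpha>\<close>. The bound to be proved says
  \<open>(p - 1) t \<le> p (L - 1)\<close>. Although it is a statement about every prime \<open>p\<close>, it follows for all of
  them from the topology of \<open>\<int>/2\<close>, in the form of one combinatorial theorem: Ky Fan's lemma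
  for the barycentric subdivision of the cross-polytope.

  The faces of the cross-polytope with vertex set \<open>V \<times> {True, False}\<close> are the consistently signed
  subsets of \<open>V\<close>. Given a proper coloring of the Kneser graph, label a signed set \<open>X\<close> by the largest
  color of an edge lying inside the positive or inside the negative part of \<open>X\<close>, with the sign of
  that part. If there is no such edge, both parts are independent, so that \<open>X\<close> has at most \<open>2\<alpha>\<close>
  elements, and the size of \<open>X\<close> serves as a label below all colors. Fan's lemma
  (\<open>odd_card_alternating_flags\<close>) yields a full flag of signed sets whose labels, in increasing
  order, alternate in sign. At most \<open>2\<alpha>\<close> of them are sizes; the others name edges of pairwise
  different colors, and edges of opposite sign are disjoint. This is a complete bipartite subgraph
  with at least \<open>n - 2\<alpha>\<close> colors and with sides differing in size by at most one
  (\<open>colorful_bipartite_kneser\<close>).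

  Two lower bounds for \<open>L\<close> follow. If \<open>n - 2\<alpha> \<ge> 2\<close>, a vertex of the smaller side sees the whole
  larger side, whence \<open>2 L \<ge> n - 2\<alpha> + 2\<close> (\<open>local_chromatic_kneser_half\<close>). And any \<open>\<alpha> + 1\<close> vertices
  contain an edge \<open>e\<close>; applied to the edges that avoid \<open>e\<close>, all of them neighbors of \<open>e\<close>, the
  bipartite subgraph shows that \<open>e\<close> sees at least \<open>(n - \<alpha> - 1) - 2\<alpha>\<close> colors besides its own,
  whence \<open>L \<ge> n - 3\<alpha>\<close> (\<open>local_chromatic_kneser_third\<close>).

  If \<open>t \<le> 0\<close>, the claim follows from \<open>L \<ge> 1\<close>. Let \<open>t > 0\<close>; then \<open>t \<ge> p\<close> if \<open>\<alpha> = 0\<close>. For \<open>p = 2\<close> and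
  \<open>t \<ge> 2\<close> the first bound is the claim, and for \<open>p = 2\<close> and \<open>t = 1\<close> two disjoint edges give \<open>L \<ge> 2\<close>. For \<open>p \<ge> 3\<close> the second one is at least as good as the
  required bound, since \<open>n - 3\<alpha> = t + (p - 3) \<alpha>\<close>, except when \<open>p = 3\<close> and \<open>t\<close> is \<open>1\<close> or \<open>2\<close>;
  there the first bound suffices.
\<close>

section \<open>Alternating sequences of signed labels\<close>

text \<open>
  A signed label is encoded as a natural number \<open>x\<close>: its absolute value is \<open>x div 2\<close>, and it is
  positive iff \<open>x\<close> is odd. The parameter \<open>s\<close> is the sign of the first label. The order compares
  absolute values first; that it also puts the negative label of an absolute value before the
  positive one does no harm, because opposite labels will never occur together.
\<close>

fun alternating :: "bool \<Rightarrow> nat list \<Rightarrow> bool" where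
  "alternating s [] = True"
| "alternating s (x # xs) \<longleftrightarrow> odd x = s \<and> (\<forall>y\<in>set xs. x < y) \<and> alternating (\<not> s) xs"

definition alternating_mset :: "bool \<Rightarrow> nat multiset \<Rightarrow> bool" where
  "alternating_mset s M \<longleftrightarrow> alternating s (sorted_list_of_multiset M)"

lemma card_less_Suc_split:
  "card {i. i < Suc n \<and> P i} = of_bool (P 0) + card {i. i < n \<and> P (Suc i)}"
proof -
  have "{i. i < Suc n \<and> P i} = {i. i = 0 \<and> P i} \<union> Suc ` {i. i < n \<and> P (Suc i)}"
    by (auto simp: image_iff less_Suc_eq_0_disj)
  moreover have "{i. i = 0 \<and> P i} = (if P 0 then {0} else {})"
    by auto
  ultimately show ?thesis
    by (auto simp: card_image)
qed

lemma alternating_both: "alternating s xs \<Longrightarrow> alternating (\<not> s) xs \<Longrightarrow> xs = []"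
  by (cases xs) auto

text \<open>
  The combinatorial core of Fan's lemma. If the sequence alternates, only the deletion of its
  first or of its last element (depending on \<open>s\<close>) leaves an alternating sequence with first sign \<open>s\<close>.
  If it does not alternate but some deletion makes it so, the deleted element has a neighbor of
  its own sign, and deleting that neighbor instead works as well, so such deletions come in pairs.
\<close>

lemma odd_card_alternating_deletions_sorted:
  assumes "sorted xs" and "xs \<noteq> []"
  shows "odd (card {i. i < length xs \<and> alternating s (take i xs @ drop (Suc i) xs)})
    \<longleftrightarrow> alternating s xs \<or> alternating (\<not> s) xs"
  using assms
proof (induction xs arbitrary: s)
  case Nil
  then show ?case by simp
next
  case (Cons x ys)
  let ?del = "\<lambda>i. take i ys @ drop (Suc i) ys"
  have split: "card {i. i < length (x # ys) \<and> alternating s (take i (x # ys) @ drop (Suc i) (x # ys))}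
      = of_bool (alternating s ys)
        + card {i. i < length ys \<and> alternating s (x # ?del i)}"
    by (simp only: length_Cons card_less_Suc_split) simp
  show ?case
  proof (cases "ys = []")
    case True
    then show ?thesis unfolding split by (cases s) auto
  next
    case False
    then obtain y zs where ys: "ys = y # zs" by (cases ys) auto
    \<comment> \<open>A repeated label \<open>x = y\<close> survives unless one of the two copies is deleted, and both
      deletions give the same sequence.\<close>
    show ?thesis
    proof (cases "x = y")
      case True
      have eq: "{i. i < length ys \<and> alternating s (x # ?del i)}
          = {i. i = 0 \<and> alternating s (x # zs)}"
      proof (intro set_eqI iffI)
        fix i assume i: "i \<in> {i. i < length ys \<and> alternating s (x # ?del i)}"
        then have "i = 0" by (cases i) (auto simp: ys True)
        with i show "i \<in> {i. i = 0 \<and> alternating s (x # zs)}" by (simp add: ys)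
      qed (simp add: ys)
      have "card {i::nat. i = 0 \<and> alternating s (x # zs)} = of_bool (alternating s ys)"
        by (simp add: ys True Collect_conv_if2)
      then show ?thesis
        unfolding split eq by (simp add: ys True)
    next
      case neq: False
      have less: "\<forall>z\<in>set ys. x < z"
        using Cons.prems(1) neq unfolding ys by fastforce
      have "\<forall>z\<in>set (?del i). x < z" for i
        using less by (metis Un_iff in_set_dropD in_set_takeD set_append)
      then have "alternating s (x # ?del i) \<longleftrightarrow> odd x = s \<and> alternating (\<not> s) (?del i)" for i
        by simp
      then have eq: "{i. i < length ys \<and> alternating s (x # ?del i)}
          = (if odd x = s then {i. i < length ys \<and> alternating (\<not> s) (?del i)} else {})"
        by auto
      have IH: "odd (card {i. i < length ys \<and> alternating (\<not> s) (?del i)})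
          \<longleftrightarrow> alternating s ys \<or> alternating (\<not> s) ys"
        using Cons.IH[of "\<not> s"] Cons.prems(1) \<open>ys \<noteq> []\<close> by auto
      show ?thesis
        unfolding split eq using IH less alternating_both[of s ys] \<open>ys \<noteq> []\<close>
        by (cases "odd x = s"; cases "alternating s ys"; cases "alternating (\<not> s) ys") simp_all
    qed
  qed
qed

text \<open>
  The labels along a flag do not come sorted, so the count is transferred to multisets, where
  deleting a position becomes removing one occurrence of its label.
\<close>

lemma odd_card_alternating_deletions:
  assumes "L \<noteq> []"
  shows "odd (card {i. i < length L \<and> alternating_mset s (mset L - {#L ! i#})})
    \<longleftrightarrow> alternating_mset True (mset L) \<or> alternating_mset False (mset L)"
proof -
  define xs where "xs = sort L"
  let ?P = "\<lambda>x. alternating_mset s (mset L - {#x#})"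
  have del: "?P (xs ! i) \<longleftrightarrow> alternating s (take i xs @ drop (Suc i) xs)" if "i < length xs" for i
  proof -
    have "mset xs = mset (take i xs @ xs ! i # drop (Suc i) xs)"
      using that by (simp add: id_take_nth_drop[symmetric])
    then have "mset L - {#xs ! i#} = mset (take i xs @ drop (Suc i) xs)"
      by (simp add: xs_def)
    moreover have "sorted (take i xs @ drop (Suc i) xs)"
    proof -
      have "sorted (take i xs @ xs ! i # drop (Suc i) xs)"
        using that by (simp add: id_take_nth_drop[symmetric] xs_def)
      then show ?thesis by (auto simp: sorted_append)
    qed
    ultimately show ?thesis
      by (simp add: alternating_mset_def sorted_sort_id del: mset_append)
  qed
  have "card {i. i < length L \<and> ?P (L ! i)} = size (filter_mset ?P (mset L))"
    by (simp add: length_filter_conv_card flip: mset_filter)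
  also have "\<dots> = size (filter_mset ?P (mset xs))"
    by (simp add: xs_def)
  also have "\<dots> = card {i. i < length xs \<and> ?P (xs ! i)}"
    by (simp only: length_filter_conv_card size_mset flip: mset_filter)
  also have "\<dots> = card {i. i < length xs \<and> alternating s (take i xs @ drop (Suc i) xs)}"
    using del by (metis (no_types, lifting))
  finally have "card {i. i < length L \<and> ?P (L ! i)}
      = card {i. i < length xs \<and> alternating s (take i xs @ drop (Suc i) xs)}" .
  moreover have "xs \<noteq> []" "sorted xs"
    using assms by (auto simp: xs_def dest: arg_cong[where f = length])
  ultimately show ?thesis
    using odd_card_alternating_deletions_sorted[of xs s]
    by (cases s) (auto simp: alternating_mset_def xs_def)
qed

section \<open>Ky Fan's lemma for the cross-polytope\<close>

lemma even_card_fixed_point_free_involution: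
  assumes "finite A" and "\<And>x. x \<in> A \<Longrightarrow> f x \<in> A \<and> f (f x) = x \<and> f x \<noteq> x"
  shows "even (card A)"
proof -
  let ?C = "(\<lambda>x. {x, f x}) ` A"
  have U: "\<Union>?C = A" using assms(2) by auto
  have "2 * card ?C = card (\<Union>?C)"
  proof (rule card_partition)
    fix c d assume "c \<in> ?C" "d \<in> ?C" "c \<noteq> d"
    have orbit: "c = {z, f z}" if "c \<in> ?C" "z \<in> c" for c z
      using that assms(2) by (auto simp: insert_commute)
    show "c \<inter> d = {}"
      using orbit[OF \<open>c \<in> ?C\<close>] orbit[OF \<open>d \<in> ?C\<close>] \<open>c \<noteq> d\<close> by (metis disjoint_iff)
  next
    fix c assume "c \<in> ?C"
    then obtain x where "x \<in> A" "c = {x, f x}" by auto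
    with assms(2)[of x] show "card c = 2"
      by auto
  qed (use assms(1) U in auto)
  then show ?thesis using U by (metis dvd_triv_left)
qed

definition opposite :: "nat \<Rightarrow> nat" where
  "opposite x = (if even x then Suc x else x - 1)"

lemma odd_opposite [simp]: "odd (opposite x) \<longleftrightarrow> even x"
  by (auto simp: opposite_def)

lemma opposite_opposite [simp]: "opposite (opposite x) = x"
  by (auto simp: opposite_def)

lemma opposite_less: "x < y \<Longrightarrow> y \<noteq> opposite x \<Longrightarrow> opposite x < opposite y"
  unfolding opposite_def by (cases "even x"; cases "even y"; simp; presburger)

text \<open>
  Passing to opposite labels preserves their order as long as no two of them are opposite to each
  other. This is where Fan's hypothesis on comparable sets enters.
\<close>

lemma alternating_opposite:
  assumes "alternating s xs" and "\<And>x y. x \<in> set xs \<Longrightarrow> y \<in> set xs \<Longrightarrow> y \<noteq> opposite x"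
  shows "alternating (\<not> s) (map opposite xs)"
  using assms by (induction s xs rule: alternating.induct) (auto intro!: opposite_less)

lemma alternating_sorted: "alternating s xs \<Longrightarrow> sorted xs"
  by (induction s xs rule: alternating.induct) (auto simp: less_imp_le)

lemma alternating_mset_opposite:
  assumes "alternating_mset s (mset L)" and "\<And>x y. x \<in> set L \<Longrightarrow> y \<in> set L \<Longrightarrow> y \<noteq> opposite x"
  shows "alternating_mset (\<not> s) (mset (map opposite L))"
proof -
  have "alternating (\<not> s) (map opposite (sort L))"
    using assms by (intro alternating_opposite) (auto simp: alternating_mset_def)
  moreover from this have "sort (map opposite L) = map opposite (sort L)"
    by (intro properties_for_sort) (auto dest: alternating_sorted)
  ultimately show ?thesis by (simp add: alternating_mset_def del: mset_map)
qed


text \<open>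
  These are the nonempty faces of the cross-polytope: every vertex of \<open>V\<close> carries at most one sign.
\<close>

definition signed_sets :: "'a set \<Rightarrow> ('a \<times> bool) set set" where
  "signed_sets V = {X. X \<noteq> {} \<and> fst ` X \<subseteq> V \<and> inj_on fst X}"

abbreviation negate :: "'a \<times> bool \<Rightarrow> 'a \<times> bool" where
  "negate \<equiv> map_prod id Not"

definition fan_labelling :: "'a set \<Rightarrow> (('a \<times> bool) set \<Rightarrow> nat) \<Rightarrow> bool" where
  "fan_labelling V l \<longleftrightarrow>
     (\<forall>X\<in>signed_sets V. l (negate ` X) = opposite (l X)) \<and>
     (\<forall>X\<in>signed_sets V. \<forall>Y\<in>signed_sets V. X \<subseteq> Y \<longrightarrow> l X \<noteq> opposite (l Y))"

text \<open>
  A maximal chain of signed sets on \<open>V\<close> is given by the order in which the signed elements are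
  added; its members are the sets of elements of the nonempty prefixes.
\<close>

definition flags :: "'a set \<Rightarrow> ('a \<times> bool) list set" where
  "flags V = {ws. distinct (map fst ws) \<and> fst ` set ws = V}"

definition labels :: "(('a \<times> bool) set \<Rightarrow> nat) \<Rightarrow> ('a \<times> bool) list \<Rightarrow> nat list" where
  "labels l ws = map (\<lambda>i. l (set (take (Suc i) ws))) [0..<length ws]"

lemma length_labels [simp]: "length (labels l ws) = length ws"
  by (simp add: labels_def)

lemma nth_labels [simp]: "i < length ws \<Longrightarrow> labels l ws ! i = l (set (take (Suc i) ws))"
  by (simp add: labels_def)

lemma labels_snoc: "labels l (ws @ [w]) = labels l ws @ [l (set (ws @ [w]))]"
  by (rule nth_equalityI) (auto simp: nth_append)

lemma length_flags: "ws \<in> flags V \<Longrightarrow> length ws = card V"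
  unfolding flags_def by (metis (mono_tags, lifting) distinct_card length_map list.set_map mem_Collect_eq)

lemma finite_flags: "finite V \<Longrightarrow> finite (flags V)"
proof (rule finite_subset)
  show "flags V \<subseteq> {ws. set ws \<subseteq> V \<times> UNIV \<and> length ws = card V}"
    using length_flags[of _ V] by (force simp: flags_def)
qed (simp add: finite_lists_length_eq)

lemma set_take_signed:
  assumes "ws \<in> flags V" and "i < length ws"
  shows "set (take (Suc i) ws) \<in> signed_sets V"
proof -
  have "take (Suc i) ws \<noteq> []" using assms(2) by auto
  moreover have "inj_on fst (set ws)" using assms(1) by (simp add: flags_def distinct_map)
  ultimately show ?thesis
    using assms set_take_subset[of "Suc i" ws]
    by (auto simp: signed_sets_def flags_def intro: inj_on_subset)
qed

lemma labels_not_opposite: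
  assumes "fan_labelling V l" and "ws \<in> flags V"
    and "x \<in> set (labels l ws)" and "y \<in> set (labels l ws)"
  shows "y \<noteq> opposite x"
proof -
  obtain i where i: "i < length ws" "x = l (set (take (Suc i) ws))"
    using assms(3) by (auto simp: labels_def)
  obtain j where j: "j < length ws" "y = l (set (take (Suc j) ws))"
    using assms(4) by (auto simp: labels_def)
  note signed = set_take_signed[OF assms(2) i(1)] set_take_signed[OF assms(2) j(1)]
  show ?thesis
  proof (cases "i \<le> j")
    case True
    then have "set (take (Suc i) ws) \<subseteq> set (take (Suc j) ws)" by (simp add: set_take_subset_set_take)
    then have "x \<noteq> opposite y" using assms(1) signed unfolding i j fan_labelling_def by blast
    then show ?thesis by (metis opposite_opposite)
  next
    case False
    then have "set (take (Suc j) ws) \<subseteq> set (take (Suc i) ws)" by (simp add: set_take_subset_set_take)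
    then show ?thesis using assms(1) signed unfolding i j fan_labelling_def by blast
  qed
qed

lemma map_negate_flags: "ws \<in> flags V \<Longrightarrow> map negate ws \<in> flags V"
  by (auto simp: flags_def image_image comp_def)

lemma labels_map_negate:
  assumes "fan_labelling V l" and "ws \<in> flags V"
  shows "labels l (map negate ws) = map opposite (labels l ws)"
  using assms set_take_signed[OF assms(2)]
  by (intro nth_equalityI) (auto simp: fan_labelling_def take_map)

lemma alternating_map_negate:
  assumes "fan_labelling V l" and "ws \<in> flags V" and "alternating_mset s (mset (labels l ws))"
  shows "alternating_mset (\<not> s) (mset (labels l (map negate ws)))"
  unfolding labels_map_negate[OF assms(1,2)]
  using assms(3) labels_not_opposite[OF assms(1,2)] by (intro alternating_mset_opposite)

text \<open>
  Each member of a full flag can be exchanged in exactly one way for another signed set: for an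
  inner member, by swapping the order in which two consecutive elements are added; for the top
  one, by changing the sign of the last element. All other members stay the same.
\<close>

definition pivot :: "('a \<times> bool) list \<Rightarrow> nat \<Rightarrow> ('a \<times> bool) list" where
  "pivot ws i = (if Suc i < length ws then ws[i := ws ! Suc i, Suc i := ws ! i]
     else ws[i := negate (ws ! i)])"

lemma length_pivot [simp]: "length (pivot ws i) = length ws"
  by (simp add: pivot_def)

lemma pivot_pivot: "i < length ws \<Longrightarrow> pivot (pivot ws i) i = ws"
  by (rule nth_equalityI) (auto simp: pivot_def nth_list_update prod.map_comp prod.map_id0 comp_def prod_eq_iff)

lemma pivot_neq: "i < length ws \<Longrightarrow> distinct (map fst ws) \<Longrightarrow> pivot ws i \<noteq> ws"
proof
  assume i: "i < length ws" "distinct (map fst ws)" and eq: "pivot ws i = ws"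
  show False
  proof (cases "Suc i < length ws")
    case True
    then have "ws ! Suc i = ws ! i"
      using arg_cong[OF eq, of "\<lambda>xs. xs ! i"] by (simp add: pivot_def)
    then have "map fst ws ! Suc i = map fst ws ! i"
      using True by simp
    then show False
      using i True by (subst (asm) nth_eq_iff_index_eq) auto
  next
    case False
    then have "negate (ws ! i) = ws ! i"
      using arg_cong[OF eq, of "\<lambda>xs. xs ! i"] i by (simp add: pivot_def)
    then show False by (simp add: prod_eq_iff)
  qed
qed

lemma pivot_flags:
  assumes "ws \<in> flags V" and "i < length ws"
  shows "pivot ws i \<in> flags V"
proof -
  have "mset (map fst (pivot ws i)) = mset (map fst ws)"
  proof (cases "Suc i < length ws")
    case True
    then have "mset (pivot ws i) = mset ws"
      using mset_swap[of i ws "Suc i"] by (simp add: pivot_def list_update_swap)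
    then show ?thesis by simp
  next
    case False
    then have "map fst (pivot ws i) = map fst ws"
      using assms(2) by (intro nth_equalityI) (auto simp: pivot_def nth_list_update)
    then show ?thesis by simp
  qed
  then show ?thesis
    using assms(1) unfolding flags_def
    by (metis (mono_tags, lifting) list.set_map mem_Collect_eq mset_eq_imp_distinct_iff mset_eq_setD)
qed

lemma set_take_pivot:
  assumes "i < length ws" and "j < length ws" and "j \<noteq> i"
  shows "set (take (Suc j) (pivot ws i)) = set (take (Suc j) ws)"
proof (cases "j < i")
  case True
  then show ?thesis by (simp add: pivot_def)
next
  case False
  define us where "us = take (Suc j) ws"
  have less: "Suc i < length ws" "i < length us" "Suc i < length us"
    using False assms by (auto simp: us_def)
  then have "take (Suc j) (pivot ws i) = us[i := us ! Suc i, Suc i := us ! i]"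
    by (simp add: pivot_def us_def take_update_swap)
  moreover have "mset (us[i := us ! Suc i, Suc i := us ! i]) = mset us"
    using less mset_swap[of i us "Suc i"] by (simp add: list_update_swap)
  ultimately show ?thesis
    unfolding us_def by (metis mset_eq_setD)
qed

lemma labels_pivot:
  assumes "i < length ws"
  shows "mset (labels l (pivot ws i)) - {#labels l (pivot ws i) ! i#}
    = mset (labels l ws) - {#labels l ws ! i#}"
proof -
  have "labels l (pivot ws i) = (labels l ws)[i := l (set (take (Suc i) (pivot ws i)))]"
    using assms by (intro nth_equalityI) (auto simp: nth_list_update set_take_pivot)
  then show ?thesis
    using assms by (simp add: mset_update)
qed

lemma fan_labelling_mono: "fan_labelling V l \<Longrightarrow> U \<subseteq> V \<Longrightarrow> fan_labelling U l"
  using subsetD[of "signed_sets U" "signed_sets V"]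
  unfolding fan_labelling_def by (simp add: signed_sets_def subset_iff)

lemma snoc_flags_iff:
  assumes "v \<notin> U"
  shows "ws @ [(v, b)] \<in> flags (insert v U) \<longleftrightarrow> ws \<in> flags U"
proof -
  have "v \<notin> fst ` set ws \<Longrightarrow> insert v (fst ` set ws) = insert v U \<longleftrightarrow> fst ` set ws = U"
    using assms by (simp add: insert_ident)
  then show ?thesis
    using assms unfolding flags_def by (cases "v \<in> fst ` set ws") auto
qed

text \<open>
  Ky Fan's lemma, by induction on the dimension. The flags in which \<open>v\<close> is positive form a
  hemisphere \<open>H\<close>. Count the pairs \<open>Q\<close> of a flag in \<open>H\<close> and a position whose deletion leaves alternating
  labels with positive first sign. Pivoting at the deleted position pairs them up, except for those
  in the set \<open>B\<close> where the pivot would leave \<open>H\<close>: there the deleted member is the top one and \<open>v\<close> was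
  added last, so that the remaining chain is a flag of the equator, a cross-polytope on \<open>U\<close>. On the
  other hand each flag in \<open>H\<close> belongs to an odd number of pairs iff its labels alternate, with either
  first sign, and the antipodal map turns those with negative first sign into the flags outside \<open>H\<close>
  with positive first sign.
\<close>

theorem odd_card_alternating_flags:
  assumes "finite V" and "fan_labelling V l"
  shows "odd (card {ws \<in> flags V. alternating_mset True (mset (labels l ws))})"
  using assms
proof (induction V rule: finite_induct)
  case empty
  have "{ws \<in> flags {}. alternating_mset True (mset (labels l ws))} = {[]}"
    by (auto simp: flags_def labels_def alternating_mset_def)
  then show ?case by simp
next
  case (insert v U)
  let ?V = "insert v U" and ?n = "card U"
  let ?alt = "\<lambda>s ws. alternating_mset s (mset (labels l ws))"
  let ?facet = "\<lambda>ws i. alternating_mset True (mset (labels l ws) - {#labels l ws ! i#})"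
  note fin = finite_flags[OF finite.insertI[OF \<open>finite U\<close>, of v]]
  have len: "length ws = Suc ?n" if "ws \<in> flags ?V" for ws
    using length_flags[OF that] insert by simp
  define H where "H = {ws \<in> flags ?V. (v, True) \<in> set ws}"
  define Q where "Q = (SIGMA ws:H. {i. i < Suc ?n \<and> ?facet ws i})"
  define B where "B = {(ws, i) \<in> Q. i = ?n \<and> last ws = (v, True)}"
  have finH: "finite H" using fin by (simp add: H_def)
  then have finQ: "finite Q" by (auto simp: Q_def)

  have sign: "(v, True) \<in> set ws \<longleftrightarrow> (v, False) \<notin> set ws" if "ws \<in> flags ?V" for ws
  proof -
    have "v \<in> fst ` set ws" "inj_on fst (set ws)"
      using that by (auto simp: flags_def distinct_map)
    then obtain b where "(v, b) \<in> set ws" "(v, \<not> b) \<notin> set ws"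
      by (force simp: inj_on_def)
    then show ?thesis by (cases b) auto
  qed

  have "even (card (Q - B))"
  proof (rule even_card_fixed_point_free_involution)
    fix q assume q: "q \<in> Q - B"
    obtain ws i where wi: "q = (ws, i)" by (cases q)
    have ws: "ws \<in> flags ?V" "(v, True) \<in> set ws" and i: "i < Suc ?n" "?facet ws i"
      and notB: "\<not> (i = ?n \<and> last ws = (v, True))"
      using q by (auto simp: wi Q_def B_def H_def)
    have i': "i < length ws" using i len[OF ws(1)] by simp
    have pf: "pivot ws i \<in> flags ?V" using pivot_flags[OF ws(1) i'] .
    have keep: "(v, True) \<in> set (pivot ws i)" "\<not> (i = ?n \<and> last (pivot ws i) = (v, True))"
    proof -
      have last: "last ws = ws ! i \<and> last (pivot ws i) = negate (ws ! i)" if "i = ?n"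
      proof -
        have "ws \<noteq> []" "pivot ws i \<noteq> []"
          using i' by (auto simp flip: length_0_conv)
        then show ?thesis
          using that len[OF ws(1)] by (simp add: last_conv_nth) (simp add: pivot_def)
      qed
      show "\<not> (i = ?n \<and> last (pivot ws i) = (v, True))"
      proof
        assume *: "i = ?n \<and> last (pivot ws i) = (v, True)"
        with last have "ws ! i = (v, False)" by (cases "ws ! i") auto
        then have "(v, False) \<in> set ws" using i' by (metis nth_mem)
        then show False using sign ws by blast
      qed
      show "(v, True) \<in> set (pivot ws i)"
      proof (cases "i = ?n")
        case True
        obtain k where k: "k < length ws" "ws ! k = (v, True)"
          using ws(2) by (auto simp: in_set_conv_nth)
        then have "k \<noteq> i" using last True notB by auto
        then have "pivot ws i ! k = (v, True)"
          using k True len[OF ws(1)] by (simp add: pivot_def)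
        then show ?thesis using k by (metis length_pivot nth_mem)
      next
        case False
        then have "Suc i < length ws" using i len[OF ws(1)] by simp
        then show ?thesis using ws(2) by (simp add: pivot_def)
      qed
    qed
    have "(pivot ws i, i) \<in> Q - B"
      using keep pf i labels_pivot[OF i', of l] by (simp add: Q_def B_def H_def)
    then show "(\<lambda>(ws, i). (pivot ws i, i)) q \<in> Q - B \<and>
        (\<lambda>(ws, i). (pivot ws i, i)) ((\<lambda>(ws, i). (pivot ws i, i)) q) = q \<and>
        (\<lambda>(ws, i). (pivot ws i, i)) q \<noteq> q"
      using pivot_pivot[OF i'] pivot_neq[OF i'] ws(1) by (simp add: wi flags_def)
  qed (use finQ in auto)
  moreover have "card Q = card (Q - B) + card B"
  proof -
    have "B \<subseteq> Q" by (auto simp: B_def)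
    moreover from this have "finite B" using finQ finite_subset by blast
    ultimately show ?thesis
      using card_mono[OF finQ] by (simp add: card_Diff_subset)
  qed
  moreover have "card B = card {ws \<in> flags U. ?alt True ws}"
  proof -
    have "B = (\<lambda>ws. (ws @ [(v, True)], ?n)) ` {ws \<in> flags U. ?alt True ws}"
      (is "_ = ?f ` ?A")
    proof (intro subset_antisym subsetI)
      fix q assume "q \<in> ?f ` ?A"
      then obtain ws where ws: "ws \<in> flags U" "?alt True ws" "q = (ws @ [(v, True)], ?n)" by auto
      moreover have "length ws = ?n" using length_flags ws by blast
      ultimately show "q \<in> B"
        using insert(2) by (simp add: B_def Q_def H_def snoc_flags_iff labels_snoc nth_append)
    next
      fix q assume "q \<in> B"
      then obtain ws where ws: "q = (ws, ?n)" "ws \<in> flags ?V" "?facet ws ?n" "last ws = (v, True)"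
        by (auto simp: B_def Q_def H_def)
      define us where "us = butlast ws"
      have "ws \<noteq> []" using len[OF ws(2)] by auto
      then have snoc: "ws = us @ [(v, True)]" using ws(4) us_def by (metis append_butlast_last_id)
      moreover have "us \<in> flags U" using ws(2) snoc insert(2) by (simp add: snoc_flags_iff)
      moreover from this have "length us = ?n" by (rule length_flags)
      ultimately show "q \<in> ?f ` ?A"
        using ws by (auto simp: labels_snoc nth_append)
    qed
    then show ?thesis by (simp add: card_image inj_on_def)
  qed
  moreover have "even (card Q) \<longleftrightarrow> even (card {ws \<in> H. ?alt True ws \<or> ?alt False ws})"
  proof -
    have "card Q = (\<Sum>ws\<in>H. card {i. i < Suc ?n \<and> ?facet ws i})"
      using finH by (simp add: Q_def card_SigmaI)
    moreover have "odd (card {i. i < Suc ?n \<and> ?facet ws i}) \<longleftrightarrow> ?alt True ws \<or> ?alt False ws"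
      if "ws \<in> H" for ws
    proof -
      have length: "length (labels l ws) = Suc ?n" using that len by (simp add: H_def)
      then have "labels l ws \<noteq> []" by (metis length_0_conv nat.distinct(1))
      from odd_card_alternating_deletions[OF this, of True] show ?thesis
        unfolding length .
    qed
    then have "{ws \<in> H. odd (card {i. i < Suc ?n \<and> ?facet ws i})}
        = {ws \<in> H. ?alt True ws \<or> ?alt False ws}"
      by blast
    ultimately show ?thesis
      by (simp only: even_sum_iff[OF finH])
  qed
  moreover have "card {ws \<in> H. ?alt True ws \<or> ?alt False ws} = card {ws \<in> flags ?V. ?alt True ws}"
  proof -
    have "{ws \<in> H. ?alt True ws \<or> ?alt False ws} = {ws \<in> H. ?alt True ws} \<union> {ws \<in> H. ?alt False ws}"
      by auto
    moreover have "{ws \<in> H. ?alt True ws} \<inter> {ws \<in> H. ?alt False ws} = {}"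
    proof -
      have "ws \<notin> H" if "?alt True ws" "?alt False ws" for ws
      proof -
        have "sorted_list_of_multiset (mset (labels l ws)) = []"
          using that alternating_both[of True] by (simp add: alternating_mset_def)
        then have "mset (labels l ws) = {#}"
          by (metis mset.simps(1) mset_sorted_list_of_multiset)
        then have "ws = []" by (simp flip: length_0_conv)
        then show ?thesis by (simp add: H_def)
      qed
      then show ?thesis by blast
    qed
    moreover have "card {ws \<in> H. ?alt False ws} = card {ws \<in> flags ?V - H. ?alt True ws}"
    proof (rule bij_betw_same_card)
      have swap: "map negate ws \<in> H \<longleftrightarrow> ws \<notin> H" if "ws \<in> flags ?V" for ws
        using that sign[OF that] by (force simp: H_def map_negate_flags image_iff)
      have inv: "map negate (map negate ws) = ws" for ws :: "('a \<times> bool) list"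
        by (simp add: comp_def prod.map_comp map_idI)
      show "bij_betw (map negate) {ws \<in> H. ?alt False ws} {ws \<in> flags ?V - H. ?alt True ws}"
      proof (rule bij_betw_byWitness[where f' = "map negate"])
        show "map negate ` {ws \<in> H. ?alt False ws} \<subseteq> {ws \<in> flags ?V - H. ?alt True ws}"
        proof (intro image_subsetI)
          fix ws assume "ws \<in> {ws \<in> H. ?alt False ws}"
          then have "ws \<in> H" "ws \<in> flags ?V" "?alt False ws" by (auto simp: H_def)
          then show "map negate ws \<in> {ws \<in> flags ?V - H. ?alt True ws}"
            using alternating_map_negate[OF insert.prems, of ws False] swap[of ws]
            by (simp add: map_negate_flags)
        qed
        show "map negate ` {ws \<in> flags ?V - H. ?alt True ws} \<subseteq> {ws \<in> H. ?alt False ws}"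
        proof (intro image_subsetI)
          fix ws assume "ws \<in> {ws \<in> flags ?V - H. ?alt True ws}"
          then have "ws \<notin> H" "ws \<in> flags ?V" "?alt True ws" by auto
          then show "map negate ws \<in> {ws \<in> H. ?alt False ws}"
            using alternating_map_negate[OF insert.prems, of ws True] swap[of ws] by simp
        qed
      qed (simp_all only: inv simp_thms ball_simps)
    qed
    moreover have "{ws \<in> flags ?V. ?alt True ws} = {ws \<in> H. ?alt True ws} \<union> {ws \<in> flags ?V - H. ?alt True ws}"
      by (auto simp: H_def)
    moreover have "card ({ws \<in> H. ?alt True ws} \<union> {ws \<in> flags ?V - H. ?alt True ws})
        = card {ws \<in> H. ?alt True ws} + card {ws \<in> flags ?V - H. ?alt True ws}"
      using finH fin by (intro card_Un_disjoint) auto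
    moreover have "card ({ws \<in> H. ?alt True ws} \<union> {ws \<in> H. ?alt False ws})
        = card {ws \<in> H. ?alt True ws} + card {ws \<in> H. ?alt False ws}"
      using finH calculation(2) by (intro card_Un_disjoint) auto
    ultimately show ?thesis by simp
  qed
  moreover have "odd (card {ws \<in> flags U. ?alt True ws})"
    using insert fan_labelling_mono by blast
  ultimately show ?case by (metis even_add)
qed

section \<open>Complete bipartite subgraphs with many colors\<close>

lemma opposite_div_2 [simp]: "opposite x div 2 = x div 2"
  by (cases "even x") (auto simp: opposite_def elim!: evenE oddE)

lemma eq_if_div_2_eq: "x div 2 = y div 2 \<Longrightarrow> odd x = odd y \<Longrightarrow> x = (y::nat)"
  by (metis even_two_times_div_two odd_two_times_div_two_succ)

lemma alternating_distinct: "alternating s xs \<Longrightarrow> distinct xs"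
  by (induction s xs rule: alternating.induct) auto

lemma alternating_filter_ge: "alternating s xs \<Longrightarrow> \<exists>s'. alternating s' (filter (\<lambda>x. m \<le> x) xs)"
proof (induction s xs rule: alternating.induct)
  case (2 s x xs)
  show ?case
  proof (cases "m \<le> x")
    case True
    then have "filter (\<lambda>y. m \<le> y) (x # xs) = x # xs"
      using 2(2) by (intro filter_True) auto
    then show ?thesis using 2(2) by metis
  next
    case False
    then show ?thesis using 2 by simp
  qed
qed simp

lemma alternating_parity_count:
  "alternating s xs \<Longrightarrow> length (filter (\<lambda>x. odd x = s) xs) = length (filter (\<lambda>x. odd x \<noteq> s) xs)
    \<or> length (filter (\<lambda>x. odd x = s) xs) = Suc (length (filter (\<lambda>x. odd x \<noteq> s) xs))"
  by (induction s xs rule: alternating.induct) auto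

text \<open>
  Discarding the labels below a bound removes an initial segment of the increasing sequence, so the
  remaining signs still alternate, and each occurs as often as the other up to one.
\<close>

lemma alternating_balanced:
  assumes "alternating s xs"
  shows "card {x \<in> set xs. m \<le> x \<and> odd x} \<le> Suc (card {x \<in> set xs. m \<le> x \<and> even x})"
    and "card {x \<in> set xs. m \<le> x \<and> even x} \<le> Suc (card {x \<in> set xs. m \<le> x \<and> odd x})"
proof -
  define ys where "ys = filter (\<lambda>x. m \<le> x) xs"
  obtain s' where s': "alternating s' ys"
    using alternating_filter_ge[OF assms] ys_def by blast
  have "card {x \<in> set xs. m \<le> x \<and> P x} = length (filter P ys)" for P
  proof -
    have "{x \<in> set xs. m \<le> x \<and> P x} = set (filter P ys)" by (auto simp: ys_def)
    then show ?thesis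
      using alternating_distinct[OF s'] by (metis distinct_card distinct_filter)
  qed
  then show "card {x \<in> set xs. m \<le> x \<and> odd x} \<le> Suc (card {x \<in> set xs. m \<le> x \<and> even x})"
    and "card {x \<in> set xs. m \<le> x \<and> even x} \<le> Suc (card {x \<in> set xs. m \<le> x \<and> odd x})"
    using alternating_parity_count[OF s'] by (cases s'; auto)+
qed

text \<open>
  Fan's lemma is applied to the labelling with absolute value \<open>lev\<close> and sign \<open>sgn\<close>. Comparable signed
  sets never get opposite labels: if both labels are sizes, equal sizes force equal sets; if both
  are colors, edges of the same color would lie in the positive and in the negative part of the
  larger set, hence would be disjoint.
\<close>

lemma colorful_bipartite_kneser:
  fixes c :: "'a set \<Rightarrow> nat"
  assumes "finite V"
    and indep: "\<And>S. S \<subseteq> V \<Longrightarrow> \<forall>e\<in>E. \<not> e \<subseteq> S \<Longrightarrow> card S \<le> a"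
    and proper: "\<And>e f. e \<in> E \<Longrightarrow> f \<in> E \<Longrightarrow> e \<inter> f = {} \<Longrightarrow> c e \<noteq> c f"
  obtains A B where "A \<subseteq> E" "B \<subseteq> E" "\<forall>e\<in>A \<union> B. e \<subseteq> V" "\<forall>e\<in>A. \<forall>f\<in>B. e \<inter> f = {}"
    "finite A" "finite B" "inj_on c (A \<union> B)" "card V \<le> 2 * a + card A + card B"
    "card A \<le> Suc (card B)" "card B \<le> Suc (card A)"
proof -
  define side where "side X s = {v. (v, s) \<in> X}" for X :: "('a \<times> bool) set" and s
  define cols where "cols X s = c ` {e \<in> E. e \<subseteq> side X s}" for X s
  define C where "C X = cols X True \<union> cols X False" for X
  \<comment> \<open>The shift by \<open>2 * a + 1\<close> puts every color above every size. When there is no edge, any choice of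
    an element that depends only on the underlying set gives a sign that flips with \<open>X\<close>.\<close>
  define lev where "lev X = (if C X = {} then card X else 2 * a + 1 + Max (C X))" for X
  define sgn where "sgn X = (if C X = {} then (SOME v. v \<in> fst ` X, True) \<in> X
    else Max (C X) \<in> cols X True)" for X
  define l where "l X = 2 * lev X + of_bool (sgn X)" for X
  have l_div: "l X div 2 = lev X" and l_odd: "odd (l X) = sgn X" "even (l X) = (\<not> sgn X)" for X
    by (auto simp: l_def)

  have side_sub: "side X s \<subseteq> V" and finX: "finite X"
    and side_disj: "side X True \<inter> side X False = {}" if "X \<in> signed_sets V" for X s
  proof -
    show "side X s \<subseteq> V" using that by (force simp: signed_sets_def side_def)
    show "finite X"
      using that \<open>finite V\<close> unfolding signed_sets_def
      by (metis (mono_tags, lifting) finite_imageD finite_subset mem_Collect_eq)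
    show "side X True \<inter> side X False = {}"
      using that by (force simp: signed_sets_def side_def inj_on_def)
  qed
  have cols_disj: "cols X True \<inter> cols X False = {}" if "X \<in> signed_sets V" for X
  proof -
    have "c e \<noteq> c f" if "e \<in> E" "f \<in> E" "e \<subseteq> side X True" "f \<subseteq> side X False" for e f
      using that side_disj[OF \<open>X \<in> _\<close>] by (intro proper) blast+
    then show ?thesis by (auto simp: cols_def)
  qed
  have finC: "finite (C X)" if "X \<in> signed_sets V" for X
  proof -
    have "finite {e \<in> E. e \<subseteq> side X s}" for s
      using side_sub[OF that] \<open>finite V\<close> by (auto intro: finite_subset[of _ "Pow V"])
    then show ?thesis by (auto simp: C_def cols_def)
  qed
  have cols_mono: "cols X s \<subseteq> cols Y s" if "X \<subseteq> Y" for X Y s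
    using that by (auto simp: cols_def side_def)
  have small: "card X \<le> 2 * a" if "X \<in> signed_sets V" "C X = {}" for X
  proof -
    have "card (side X s) \<le> a" for s
      using that(2) by (cases s; intro indep side_sub[OF that(1)]) (auto simp: C_def cols_def)
    moreover have "finite (side X s)" for s
      using side_sub[OF that(1)] \<open>finite V\<close> finite_subset by blast
    moreover have "X = side X True \<times> {True} \<union> side X False \<times> {False}"
      by (auto simp: side_def) (metis (full_types))+
    moreover have "card (side X True \<times> {True} \<union> side X False \<times> {False})
        \<le> card (side X True) + card (side X False)"
      using card_Un_le[of "side X True \<times> {True}" "side X False \<times> {False}"]
      by (simp add: card_cartesian_product)
    ultimately show ?thesis
      by (metis add_mono dual_order.trans mult_2)
  qed

  have "fan_labelling V l"
    unfolding fan_labelling_def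
  proof (intro conjI ballI impI)
    fix X assume X: "X \<in> signed_sets V"
    have mem: "(v, s) \<in> negate ` X \<longleftrightarrow> (v, \<not> s) \<in> X" for v s
      by force
    have cols_neg: "cols (negate ` X) s = cols X (\<not> s)" for s
      by (simp add: cols_def side_def mem)
    then have C_neg: "C (negate ` X) = C X"
      by (auto simp: C_def)
    have "inj_on negate X" by (auto simp: inj_on_def)
    then have "lev (negate ` X) = lev X"
      by (simp add: lev_def C_neg card_image)
    moreover have "sgn (negate ` X) \<longleftrightarrow> \<not> sgn X"
    proof (cases "C X = {}")
      case True
      define v where "v = (SOME v. v \<in> fst ` X)"
      have fst: "fst ` negate ` X = fst ` X" by (simp add: image_image)
      have "\<exists>v. v \<in> fst ` X" using X by (auto simp: signed_sets_def)
      then have "v \<in> fst ` X" unfolding v_def by (rule someI_ex)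
      then obtain s where s: "(v, s) \<in> X" by auto
      moreover have "(v, True) \<notin> X \<or> (v, False) \<notin> X"
        using side_disj[OF X] unfolding side_def by blast
      ultimately have "(v, False) \<in> X \<longleftrightarrow> (v, True) \<notin> X"
        by (cases s) auto
      then show ?thesis
        using True unfolding sgn_def C_neg fst v_def[symmetric] mem by simp
    next
      case False
      define M where "M = Max (C X)"
      have "M \<in> C X" using False finC[OF X] by (simp add: M_def)
      then have "M \<in> cols X False \<longleftrightarrow> M \<notin> cols X True"
        using cols_disj[OF X] by (auto simp: C_def)
      then show ?thesis
        using False by (simp add: sgn_def C_neg cols_neg flip: M_def)
    qed
    ultimately have "l (negate ` X) div 2 = opposite (l X) div 2"
        and "odd (l (negate ` X)) = odd (opposite (l X))"
      by (simp_all add: l_div l_odd)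
    then show "l (negate ` X) = opposite (l X)" by (rule eq_if_div_2_eq)
  next
    fix X Y assume X: "X \<in> signed_sets V" and Y: "Y \<in> signed_sets V" and "X \<subseteq> Y"
    show "l X \<noteq> opposite (l Y)"
    proof
      assume eq: "l X = opposite (l Y)"
      have lev: "lev X = lev Y" using arg_cong[OF eq, of "\<lambda>x. x div 2"] by (simp add: l_div)
      have sgn: "sgn X \<longleftrightarrow> \<not> sgn Y" using arg_cong[OF eq, of odd] by (simp add: l_odd)
      have C_sub: "C X \<subseteq> C Y" using cols_mono[OF \<open>X \<subseteq> Y\<close>] by (auto simp: C_def)
      show False
      proof (cases "C Y = {}")
        case True
        then have "card X = card Y" using lev C_sub by (auto simp: lev_def)
        then have "X = Y" using finX[OF Y] \<open>X \<subseteq> Y\<close> by (simp add: card_subset_eq)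
        then show False using sgn by simp
      next
        case False
        then have "C X \<noteq> {}" using lev small[OF X] by (auto simp: lev_def split: if_splits)
        define M where "M = Max (C X)"
        have "M \<in> C X"
          unfolding M_def using finC[OF X] \<open>C X \<noteq> {}\<close> by (rule Max_in)
        moreover have "M = Max (C Y)"
          using \<open>C X \<noteq> {}\<close> lev False by (simp add: lev_def M_def)
        ultimately have M: "M = Max (C Y)" "M \<in> C X" by simp_all
        have "M \<in> cols X True \<longleftrightarrow> M \<notin> cols Y True"
          using sgn False \<open>C X \<noteq> {}\<close> by (simp add: sgn_def M(1)[symmetric] M_def[symmetric])
        then show False
          using M(2) cols_disj[OF Y] cols_mono[OF \<open>X \<subseteq> Y\<close>] by (auto simp: C_def)
      qed
    qed
  qed
  then have "odd (card {ws \<in> flags V. alternating_mset True (mset (labels l ws))})"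
    by (rule odd_card_alternating_flags[OF \<open>finite V\<close>])
  then have "{ws \<in> flags V. alternating_mset True (mset (labels l ws))} \<noteq> {}"
    by (rule odd_card_imp_not_empty)
  then obtain ws where ws: "ws \<in> flags V" "alternating_mset True (mset (labels l ws))"
    by blast
  define xs where "xs = sort (labels l ws)"
  have xs: "alternating True xs" "set xs = set (labels l ws)" "distinct (labels l ws)"
    using ws(2) alternating_distinct[of True xs] by (auto simp: alternating_mset_def xs_def)
  \<comment> \<open>\<open>Z\<close> is the top of the flag; the labels in \<open>S\<close> are those that come from colors.\<close>
  define Z where "Z = set ws"
  define m where "m = 2 * (2 * a + 1)"
  define S where "S = {x \<in> set xs. m \<le> x}"
  have finS: "finite S" by (simp add: S_def)

  have witness: "\<exists>e\<in>E. e \<subseteq> side Z (odd x) \<and> x div 2 = 2 * a + 1 + c e" if "x \<in> S" for x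
  proof -
    have "x \<in> set (labels l ws)" using that by (simp add: S_def xs(2))
    then obtain i where "i < length (labels l ws)" "labels l ws ! i = x"
      unfolding in_set_conv_nth by blast
    then have i: "i < length ws" "x = l (set (take (Suc i) ws))" by simp_all
    define X where "X = set (take (Suc i) ws)"
    have X: "X \<in> signed_sets V" using set_take_signed[OF ws(1) i(1)] by (simp add: X_def)
    have x: "x = l X" using i by (simp add: X_def)
    have "2 * (2 * a + 1) \<le> l X" using that by (simp add: S_def m_def x)
    then have "2 * a + 1 \<le> lev X" unfolding l_div[symmetric] by presburger
    then have C: "C X \<noteq> {}" using small[OF X] by (auto simp: lev_def)
    then have "Max (C X) \<in> C X" by (rule Max_in[OF finC[OF X]])
    then have "Max (C X) \<in> cols X True \<or> Max (C X) \<in> cols X False"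
      by (metis C_def Un_iff)
    then have "Max (C X) \<in> cols X (sgn X)"
      using C by (cases "sgn X") (auto simp: sgn_def)
    then have "Max (C X) \<in> cols X (odd x)" by (simp only: x l_odd(1))
    then obtain e where e: "e \<in> E" "e \<subseteq> side X (odd x)" "c e = Max (C X)"
      by (auto simp: cols_def)
    have "side X (odd x) \<subseteq> side Z (odd x)"
      using set_take_subset[of "Suc i" ws] by (auto simp: side_def X_def Z_def)
    then have "e \<subseteq> side Z (odd x)" using e(2) by blast
    moreover have "x div 2 = 2 * a + 1 + c e"
      using C by (simp add: x l_div lev_def e(3))
    ultimately show ?thesis using e(1) by blast
  qed
  then obtain h where h: "h x \<in> E" "h x \<subseteq> side Z (odd x)" "x div 2 = 2 * a + 1 + c (h x)"
    if "x \<in> S" for x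
    by metis

  have "card V - 2 * a \<le> card S"
  proof -
    \<comment> \<open>Position \<open>i\<close> of the flag holds a set of size \<open>Suc i\<close>, so beyond position \<open>2 * a\<close> the label
      cannot be a size.\<close>
    let ?I = "{2 * a..<length ws}"
    have "labels l ws ! i \<in> S" if "i \<in> ?I" for i
    proof -
      define X where "X = set (take (Suc i) ws)"
      have X: "X \<in> signed_sets V" using set_take_signed[OF ws(1)] that by (simp add: X_def)
      have "distinct ws" using ws(1) by (auto simp: flags_def distinct_map)
      then have "card X = Suc i" using that by (simp add: X_def distinct_card)
      then have "C X \<noteq> {}" using small[OF X] that by auto
      then have "m \<le> l X" by (simp add: m_def l_def lev_def)
      then show ?thesis using that by (simp add: S_def xs(2) X_def flip: nth_labels)
    qed
    then have "(!) (labels l ws) ` ?I \<subseteq> S" by blast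
    moreover have "inj_on ((!) (labels l ws)) ?I"
      using xs(3) by (auto intro: inj_on_nth)
    ultimately have "card ?I \<le> card S"
      using finS by (metis card_image card_mono)
    then show ?thesis using length_flags[OF ws(1)] by simp
  qed

  define A where "A = h ` {x \<in> S. odd x}"
  define B where "B = h ` {x \<in> S. even x}"
  have Zdisj: "side Z True \<inter> side Z False = {}"
    using ws(1) by (force simp: flags_def distinct_map Z_def side_def inj_on_def)
  have inj: "x = y" if "x \<in> S" "y \<in> S" "c (h x) = c (h y)" for x y
  proof (rule eq_if_div_2_eq)
    show "x div 2 = y div 2" using h(3) that by simp
    show "odd x = odd y"
    proof (rule ccontr)
      assume "odd x \<noteq> odd y"
      then have "side Z (odd x) \<inter> side Z (odd y) = {}"
        using Zdisj by (cases "odd x") auto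
      then have "h x \<inter> h y = {}" using h(2) that by blast
      then show False using proper h(1) that by blast
    qed
  qed
  then have injh: "inj_on h S" by (auto intro: inj_onI)
  have card: "card A = card {x \<in> S. odd x}" "card B = card {x \<in> S. even x}"
    unfolding A_def B_def by (intro card_image inj_on_subset[OF injh]; blast)+
  show thesis
  proof (rule that)
    show "A \<subseteq> E" "B \<subseteq> E" using h(1) by (auto simp: A_def B_def)
    have "side Z s \<subseteq> V" for s using ws(1) by (force simp: Z_def side_def flags_def)
    then show "\<forall>e\<in>A \<union> B. e \<subseteq> V" using h(2) by (fastforce simp: A_def B_def)
    show "\<forall>e\<in>A. \<forall>f\<in>B. e \<inter> f = {}"
    proof (intro ballI)
      fix e f assume "e \<in> A" "f \<in> B"
      then have "e \<subseteq> side Z True" "f \<subseteq> side Z False"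
        using h(2) by (force simp: A_def B_def)+
      then show "e \<inter> f = {}" using Zdisj by blast
    qed
    show "finite A" "finite B" using finS by (simp_all add: A_def B_def)
    show "inj_on c (A \<union> B)" by (auto simp: A_def B_def intro!: inj_onI dest: inj)
    have "card S = card {x \<in> S. odd x} + card {x \<in> S. even x}"
      using finS by (subst card_Un_disjoint[symmetric]) (auto intro: arg_cong[of _ _ card])
    then show "card V \<le> 2 * a + card A + card B"
      using \<open>card V - 2 * a \<le> card S\<close> card by simp
    show "card A \<le> Suc (card B)" "card B \<le> Suc (card A)"
      unfolding card S_def using alternating_balanced[OF xs(1), of m] by (simp_all add: conj_assoc)
  qed
qed

section \<open>Lower bounds for the local chromatic number\<close>

lemma closed_nbhd_kneser:
  "e \<in> E \<Longrightarrow> closed_nbhd (kneser_graph E) e = insert e {f \<in> E. f \<inter> e = {}}"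
  by (auto simp: closed_nbhd_def kneser_graph_def)

lemma proper_coloring_kneser:
  "proper_coloring (kneser_graph E) c \<longleftrightarrow> (\<forall>e\<in>E. \<forall>f\<in>E. e \<inter> f = {} \<longrightarrow> c e \<noteq> c f)"
  by (auto simp: proper_coloring_def kneser_graph_def)

text \<open>
  It suffices to find, for every proper coloring, a vertex with \<open>k\<close> neighbors of different colors;
  its own color is one more. That \<open>{}\<close> is not an edge makes the graph loopless, so that proper
  colorings exist and the infimum is not a default value.
\<close>

lemma le_local_chromatic_kneser:
  assumes "finite E" and "{} \<notin> E"
    and star: "\<And>c. proper_coloring (kneser_graph E) c \<Longrightarrow>
      \<exists>e\<in>E. \<exists>D\<subseteq>E. (\<forall>f\<in>D. f \<inter> e = {}) \<and> inj_on c D \<and> k \<le> card D"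
  shows "Suc k \<le> local_chromatic_number (kneser_graph E)"
  unfolding local_chromatic_number_def
proof (rule cINF_greatest)
  obtain c :: "'a set \<Rightarrow> nat" where "inj_on c E"
    using finite_imp_inj_to_nat_seg[OF assms(1)] by blast
  then have "proper_coloring (kneser_graph E) c"
    using assms(2) by (force simp: proper_coloring_kneser dest: inj_onD)
  then show "{c. proper_coloring (kneser_graph E) c} \<noteq> {}" by blast
next
  fix c assume "c \<in> {c. proper_coloring (kneser_graph E) c}"
  then have c: "proper_coloring (kneser_graph E) c" by simp
  let ?N = "closed_nbhd (kneser_graph E)"
  obtain e D where e: "e \<in> E" and D: "D \<subseteq> E" "\<forall>f\<in>D. f \<inter> e = {}" "inj_on c D" "k \<le> card D"
    using star[OF c] by blast
  have "finite D" using D(1) assms(1) finite_subset by blast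
  have "c e \<notin> c ` D"
    using c D e by (auto simp: proper_coloring_kneser) (metis subsetD)
  then have "Suc (card D) = card (c ` insert e D)"
    using \<open>finite D\<close> D(3) by (simp add: card_image)
  also have "\<dots> \<le> card (c ` ?N e)"
    using D(1,2) e assms(1) by (intro card_mono) (auto simp: closed_nbhd_kneser)
  also have "\<dots> \<le> Max ((\<lambda>v. card (c ` ?N v)) ` verts (kneser_graph E))"
    using e assms(1) by (intro Max_ge) (auto simp: kneser_graph_def)
  finally show "Suc k \<le> Max ((\<lambda>v. card (c ` ?N v)) ` verts (kneser_graph E))"
    using D(4) by simp
qed

lemma hypergraph_finite_edges:
  assumes "hypergraph V E"
  shows "finite E" and "{} \<notin> E"
  using assms by (auto simp: hypergraph_def intro: finite_subset[of _ "Pow V"])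

lemma card_le_independence_number:
  assumes "hypergraph V E" and "S \<subseteq> V" and "\<forall>e\<in>E. \<not> e \<subseteq> S"
  shows "card S \<le> independence_number V E"
  unfolding independence_number_def
proof (rule Max_ge)
  have "{S. independent_set V E S} \<subseteq> Pow V" by (auto simp: independent_set_def)
  then have "finite {S. independent_set V E S}"
    using assms(1) by (auto simp: hypergraph_def intro: finite_subset)
  then show "finite (card ` {S. independent_set V E S})" by simp
  show "card S \<in> card ` {S. independent_set V E S}"
    using assms(2,3) by (simp add: independent_set_def)
qed

text \<open>
  The assumption makes the bipartite subgraph have at least two vertices, so that even its smaller
  side is nonempty; the larger side has at least half of the colors.
\<close>

lemma local_chromatic_kneser_half:
  assumes hyp: "hypergraph V E" and large: "2 * independence_number V E + 2 \<le> card V"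
  shows "card V + 2 \<le> 2 * independence_number V E + 2 * local_chromatic_number (kneser_graph E)"
proof -
  define a where "a = independence_number V E"
  define k where "k = (card V - 2 * a + 1) div 2"
  have "Suc k \<le> local_chromatic_number (kneser_graph E)"
  proof (rule le_local_chromatic_kneser[OF hypergraph_finite_edges[OF hyp]])
    fix c assume c: "proper_coloring (kneser_graph E) c"
    have "finite V" using hyp by (simp add: hypergraph_def)
    then obtain A B where AB: "A \<subseteq> E" "B \<subseteq> E" "\<forall>e\<in>A \<union> B. e \<subseteq> V"
      "\<forall>e\<in>A. \<forall>f\<in>B. e \<inter> f = {}" "finite A" "finite B" "inj_on c (A \<union> B)"
      "card V \<le> 2 * a + card A + card B" "card A \<le> Suc (card B)" "card B \<le> Suc (card A)"
    proof (rule colorful_bipartite_kneser)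
      show "card S \<le> a" if "S \<subseteq> V" "\<forall>e\<in>E. \<not> e \<subseteq> S" for S
        unfolding a_def using that by (rule card_le_independence_number[OF hyp])
      show "c e \<noteq> c f" if "e \<in> E" "f \<in> E" "e \<inter> f = {}" for e f
        using c that by (simp add: proper_coloring_kneser)
    qed
    have ex: "\<exists>e\<in>E. \<exists>D\<subseteq>E. (\<forall>f\<in>D. f \<inter> e = {}) \<and> inj_on c D \<and> k \<le> card D"
      if "P \<subseteq> E" "D \<subseteq> E" "\<forall>e\<in>P. \<forall>f\<in>D. f \<inter> e = {}" "inj_on c D"
        "card V \<le> 2 * a + card P + card D" "card P \<le> card D" "card D \<le> Suc (card P)" for P D
    proof -
      have "card P > 0" using that(5-7) large by (simp add: a_def)
      then obtain e where e: "e \<in> P" by (metis card.empty ex_in_conv less_irrefl)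
      have k: "k \<le> card D" using that(5,6) by (simp add: k_def)
      show ?thesis
      proof (intro bexI exI conjI)
        show "e \<in> E" using e that(1) by blast
        show "\<forall>f\<in>D. f \<inter> e = {}" using e that(3) by blast
      qed (use k that in auto)
    qed
    have inj: "inj_on c A" "inj_on c B" using AB(7) by (auto intro: inj_on_subset)
    show "\<exists>e\<in>E. \<exists>D\<subseteq>E. (\<forall>f\<in>D. f \<inter> e = {}) \<and> inj_on c D \<and> k \<le> card D"
    proof (cases "card A \<le> card B")
      case True
      have "\<forall>e\<in>A. \<forall>f\<in>B. f \<inter> e = {}" using AB(4) by blast
      then show ?thesis using AB(1,2,8,10) inj True by (intro ex[of A B])
    next
      case False
      have "\<forall>e\<in>B. \<forall>f\<in>A. f \<inter> e = {}" using AB(4) by blast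
      then show ?thesis using AB(1,2,8,9) inj False by (intro ex[of B A]) simp_all
    qed
  qed
  then show ?thesis using large unfolding k_def a_def by linarith
qed

text \<open>
  Neighbors of a small edge \<open>e\<close> are the edges of the hypergraph induced on the complement of \<open>e\<close>, whose
  independence number has not grown; here both sides of the bipartite subgraph are seen from \<open>e\<close>.
\<close>

lemma local_chromatic_kneser_third:
  assumes hyp: "hypergraph V E" and large: "independence_number V E < card V"
  shows "card V \<le> 3 * independence_number V E + local_chromatic_number (kneser_graph E)"
proof -
  define a where "a = independence_number V E"
  obtain W where W: "W \<subseteq> V" "card W = Suc a"
    using large unfolding a_def by (metis Suc_leI obtain_subset_with_card_n)
  then have "\<not> card W \<le> independence_number V E" by (simp add: a_def)
  then obtain e where e: "e \<in> E" "e \<subseteq> W"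
    using card_le_independence_number[OF hyp W(1)] by blast
  have finV: "finite V" using hyp by (simp add: hypergraph_def)
  have "finite W" using W(1) finV by (rule finite_subset)
  then have "card e \<le> Suc a" "finite e" using W e by (auto intro: finite_subset card_mono simp flip: W(2))
  then have card: "card V \<le> card (V - e) + Suc a"
    using diff_card_le_card_Diff[of e V] by simp
  define k where "k = card V - 3 * a - 1"
  have "Suc k \<le> local_chromatic_number (kneser_graph E)"
  proof (rule le_local_chromatic_kneser[OF hypergraph_finite_edges[OF hyp]])
    fix c assume c: "proper_coloring (kneser_graph E) c"
    let ?F = "{f \<in> E. f \<subseteq> V - e}"
    have "finite (V - e)" using finV by simp
    then obtain A B where AB: "A \<subseteq> ?F" "B \<subseteq> ?F" "\<forall>f\<in>A \<union> B. f \<subseteq> V - e"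
      "\<forall>f\<in>A. \<forall>g\<in>B. f \<inter> g = {}" "finite A" "finite B" "inj_on c (A \<union> B)"
      "card (V - e) \<le> 2 * a + card A + card B" "card A \<le> Suc (card B)" "card B \<le> Suc (card A)"
    proof (rule colorful_bipartite_kneser)
      show "card S \<le> a" if "S \<subseteq> V - e" "\<forall>f\<in>?F. \<not> f \<subseteq> S" for S
        unfolding a_def using that by (intro card_le_independence_number[OF hyp]) blast+
      show "c f \<noteq> c g" if "f \<in> ?F" "g \<in> ?F" "f \<inter> g = {}" for f g
        using c that by (simp add: proper_coloring_kneser)
    qed
    have "A \<inter> B = {}"
    proof (rule ccontr)
      assume "A \<inter> B \<noteq> {}"
      then obtain f where "f \<in> A" "f \<in> B" by blast
      then have "f \<inter> f = {}" "f \<in> E" using AB(1,4) by blast+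
      then show False using hypergraph_finite_edges(2)[OF hyp] by simp
    qed
    then have "k \<le> card (A \<union> B)"
      using AB card by (simp add: card_Un_disjoint k_def)
    then show "\<exists>e\<in>E. \<exists>D\<subseteq>E. (\<forall>f\<in>D. f \<inter> e = {}) \<and> inj_on c D \<and> k \<le> card D"
      using AB(1,2,7) e(1) by (intro bexI[of _ e] exI[of _ "A \<union> B"]) auto
  qed
  then show ?thesis unfolding k_def a_def by linarith
qed

theorem corollary3:
  fixes V :: "'a set" and E :: "'a set set" and p :: nat
  assumes "hypergraph V E"
    and "prime p"
    and "E \<noteq> {}"
    and "independence_number V E = 0 \<Longrightarrow> p \<le> card V"
    and "p = 2 \<Longrightarrow> card V = 2 * independence_number V E + 1 \<Longrightarrow> \<exists>e\<in>E. \<exists>f\<in>E. e \<inter> f = {}"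
  shows "int (local_chromatic_number (kneser_graph E)) \<ge>
           \<lceil>(real p - 1) * real (card V) / real p\<rceil>
             - (int p - 1) * int (independence_number V E) + 1"
proof -
  define n where "n = int (card V)"
  define a where "a = int (independence_number V E)"
  define L where "L = int (local_chromatic_number (kneser_graph E))"
  define q where "q = int p"
  define t where "t = n - q * a"
  have "q \<ge> 2" using prime_ge_2_nat[OF assms(2)] by (simp add: q_def)
  have "a \<ge> 0" by (simp add: a_def)
  have half: "n + 2 \<le> 2 * a + 2 * L" if "2 * a + 2 \<le> n"
    using local_chromatic_kneser_half[OF assms(1)] that by (simp add: n_def a_def L_def)
  have third: "n \<le> 3 * a + L" if "a < n"
    using local_chromatic_kneser_third[OF assms(1)] that by (simp add: n_def a_def L_def)
  have one: "1 \<le> L"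
  proof -
    have "Suc 0 \<le> local_chromatic_number (kneser_graph E)"
    proof (intro le_local_chromatic_kneser hypergraph_finite_edges[OF assms(1)])
      obtain e where "e \<in> E" using assms(3) by blast
      then show "\<exists>e\<in>E. \<exists>D\<subseteq>E. (\<forall>f\<in>D. f \<inter> e = {}) \<and> inj_on c D \<and> 0 \<le> card D" for c :: "'a set \<Rightarrow> nat"
        by (intro bexI[of _ e] exI[of _ "{}"]) auto
    qed
    then show ?thesis by (simp add: L_def)
  qed
  have two: "2 \<le> L" if "q = 2" "t = 1"
  proof -
    have "card V = 2 * independence_number V E + 1" "p = 2"
      using that by (simp_all add: t_def n_def a_def q_def)
    then obtain e f where ef: "e \<in> E" "f \<in> E" "e \<inter> f = {}" using assms(5) by blast
    have "Suc 1 \<le> local_chromatic_number (kneser_graph E)"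
    proof (intro le_local_chromatic_kneser hypergraph_finite_edges[OF assms(1)])
      show "\<exists>e\<in>E. \<exists>D\<subseteq>E. (\<forall>f\<in>D. f \<inter> e = {}) \<and> inj_on c D \<and> 1 \<le> card D" for c :: "'a set \<Rightarrow> nat"
        using ef by (intro bexI[of _ f] exI[of _ "{e}"]) auto
    qed
    then show ?thesis by (simp add: L_def)
  qed
  have zero: "q \<le> t" if "a = 0"
    using assms(4) that by (simp add: a_def t_def n_def q_def)

  \<comment> \<open>After substituting \<open>n = t + q a\<close> and clearing the denominator, this is the claim.\<close>
  have "(q - 1) * t \<le> q * (L - 1)"
  proof -
    consider "t \<le> 0" | "t > 0" "q = 2" | "t > 0" "q = 3" "t < 3" | "t > 0" "q \<ge> 3" "q \<le> t"
      | "t > 0" "q \<ge> 4" "t < q"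
      using \<open>q \<ge> 2\<close> by linarith
    then show ?thesis
    proof cases
      case 1
      then have "(q - 1) * t \<le> 0" "0 \<le> q * (L - 1)"
        using \<open>q \<ge> 2\<close> one by (simp_all add: mult_nonneg_nonpos)
      then show ?thesis by linarith
    next
      case 2
      then show ?thesis using half two by (cases "t = 1") (auto simp: t_def)
    next
      case 3
      then have "a \<ge> 1" using zero \<open>a \<ge> 0\<close> by fastforce
      then show ?thesis using half 3 by (cases "t = 1") (auto simp: t_def)
    next
      case 4
      have "q * a \<ge> 3 * a" using 4 \<open>a \<ge> 0\<close> by (intro mult_right_mono)
      then have "t \<le> L" using third 4 \<open>a \<ge> 0\<close> by (simp add: t_def)
      then have "q * t \<le> q * L" using 4 by simp
      then show ?thesis using 4 unfolding left_diff_distrib right_diff_distrib by linarith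
    next
      case 5
      then have "a \<ge> 1" using zero \<open>a \<ge> 0\<close> by fastforce
      have "q * a \<ge> 4 * a" using 5 \<open>a \<ge> 0\<close> by (intro mult_right_mono) auto
      moreover from this have "a < n" using 5 \<open>a \<ge> 1\<close> unfolding t_def by linarith
      ultimately have "t \<le> L - 1" using third \<open>a \<ge> 1\<close> unfolding t_def by linarith
      then have "q * t \<le> q * (L - 1)" using 5 by (intro mult_left_mono) auto
      then show ?thesis using 5 unfolding left_diff_distrib by linarith
    qed
  qed
  then have "(q - 1) * n \<le> (L - 1 + (q - 1) * a) * q"
    by (simp add: t_def algebra_simps)
  then have "real_of_int ((q - 1) * n) \<le> real_of_int ((L - 1 + (q - 1) * a) * q)"
    by (simp only: of_int_le_iff)
  then have "(real p - 1) * real (card V) \<le> of_int (L - 1 + (q - 1) * a) * real p"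
    by (simp add: n_def q_def)
  then have "(real p - 1) * real (card V) / real p \<le> of_int (L - 1 + (q - 1) * a)"
    using \<open>q \<ge> 2\<close> by (simp add: q_def divide_le_eq)
  then have "\<lceil>(real p - 1) * real (card V) / real p\<rceil> \<le> L - 1 + (q - 1) * a"
    by (simp add: ceiling_le_iff)
  then show ?thesis by (simp add: L_def q_def a_def)
qed

end
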